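(* Let $G$ be any graph and let $k,t\in\mathbb{N}$. If $t \geq \left(P_{DP}(G,\chi_{DP}(G)+k-1)\right)^{k}$, then $\chi_{DP}(G\square K_{k,t}) = \chi_{DP}(G) + k$.
   Context: All graphs are finite, simple and nonempty. $K_{k,t}$ is the complete bipartite graph with parts of sizes $k$ and $t$. $G\square H$ is the Cartesian product: vertex set $V(G)\times V(H)$, with $(u,v)\sim(u',v')$ iff either $u=u'$ and $vv'\in E(H)$, or $v=v'$ and $uu'\in E(G)$. A cover of a graph $G$ is a pair $\mathcal{H}=(L,H)$ where $H$ is a graph and $L:V(G)\to\mathcal{P}(V(H))$ such that: (1) $\{L(v):v\in V(G)\}$ partitions $V(H)$ into $|V(G)|$ parts; (2) each $H[L(v)]$ is complete; (3) if there is an edge of $H$ between $L(u)$ and $L(v)$ then $u=v$ or $uv\in E(G)$; (4) if $uv\in E(G)$ the edges of $H$ between $L(u)$ and $L(v)$ form a (possibly empty) matching. It is $m$-fold if $|L(v)|=m$ for all $v$. An $\mathcal{H}$-coloring of $G$ is an independent set of $H$ of size $|V(G)|$. $\chi_{DP}(G)$ is the least $m$ such that $G$ admits an $\mathcal{H}$-coloring for every $m$-fold cover $\mathcal{H}$. For a cover $\mathcal{H}$, $P_{DP}(G,\mathcal{H})$ is the number of $\mathcal{H}$-colorings of $G$, and the DP color function $P_{DP}(G,m)$ is the minimum of $P_{DP}(G,\mathcal{H})$ over all $m$-fold covers $\mathcal{H}$ of $G$. *)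

theory Defs
  imports "Graph_Theory.Graph_Theory" "HOL-Library.Disjoint_Sets"
begin

text \<open>
  Graphs are the symmetric loop-free pair digraphs of \<^locale>\<open>pair_graph\<close>: every edge \<open>uv\<close>
  appears as the two arcs \<open>(u, v)\<close> and \<open>(v, u)\<close>. That locale allows the empty graph, which is
  excluded here.
\<close>

definition nonempty_graph :: "'a pair_pre_digraph \<Rightarrow> bool" where
  "nonempty_graph G \<longleftrightarrow> pair_graph G \<and> pverts G \<noteq> {}"

definition cartesian_product ::
    "'a pair_pre_digraph \<Rightarrow> 'b pair_pre_digraph \<Rightarrow> ('a \<times> 'b) pair_pre_digraph"
    (infixr \<open>\<box>\<close> 80) where
  "G \<box> H = \<lparr> pverts = pverts G \<times> pverts H,
     parcs = {((u, v), (u', v')) | u v u' v'.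
       (u, v) \<in> pverts G \<times> pverts H \<and> (u', v') \<in> pverts G \<times> pverts H \<and>
       (u = u' \<and> (v, v') \<in> parcs H \<or> v = v' \<and> (u, u') \<in> parcs G)} \<rparr>"

definition edges_between :: "'a pair_pre_digraph \<Rightarrow> 'a set \<Rightarrow> 'a set \<Rightarrow> 'a set set" where
  "edges_between H A B = {{x, y} | x y. x \<in> A \<and> y \<in> B \<and> (x, y) \<in> parcs H}"

definition matching :: "'a set set \<Rightarrow> bool" where
  "matching M \<longleftrightarrow> pairwise disjnt M"

definition dp_cover ::
    "'a pair_pre_digraph \<Rightarrow> ('a \<Rightarrow> 'b set) \<Rightarrow> 'b pair_pre_digraph \<Rightarrow> bool" where
  "dp_cover G L H \<longleftrightarrow>
     nonempty_graph H \<and>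
     partition_on (pverts H) (L ` pverts G) \<and> card (L ` pverts G) = card (pverts G) \<and>
     (\<forall>v \<in> pverts G. complete_digraph (card (L v)) (with_proj H \<restriction> L v)) \<and>
     (\<forall>u \<in> pverts G. \<forall>v \<in> pverts G.
        edges_between H (L u) (L v) \<noteq> {} \<longrightarrow> u = v \<or> (u, v) \<in> parcs G) \<and>
     (\<forall>u v. (u, v) \<in> parcs G \<longrightarrow> matching (edges_between H (L u) (L v)))"

definition fold_cover ::
    "nat \<Rightarrow> 'a pair_pre_digraph \<Rightarrow> ('a \<Rightarrow> 'b set) \<Rightarrow> 'b pair_pre_digraph \<Rightarrow> bool" where
  "fold_cover m G L H \<longleftrightarrow> dp_cover G L H \<and> (\<forall>v \<in> pverts G. card (L v) = m)"

definition independent_set :: "'a pair_pre_digraph \<Rightarrow> 'a set \<Rightarrow> bool" where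
  "independent_set H I \<longleftrightarrow> I \<subseteq> pverts H \<and> (\<forall>x \<in> I. \<forall>y \<in> I. (x, y) \<notin> parcs H)"

text \<open>The set of \<open>\<H>\<close>-colorings depends on the cover \<open>\<H> = (L, H)\<close> only through \<open>H\<close>.\<close>

definition dp_colorings :: "'a pair_pre_digraph \<Rightarrow> 'b pair_pre_digraph \<Rightarrow> 'b set set" where
  "dp_colorings G H = {I. independent_set H I \<and> card I = card (pverts G)}"

text \<open>
  The two invariants below quantify over all covers, so a vertex type for \<open>H\<close> has to be fixed.
  As \<open>H\<close> is finite, \<^typ>\<open>nat\<close> loses nothing; see \<open>fold_cover_nat\<close> below.

  Since the parts of a partition are nonempty, there are no 0-fold covers; \<open>m\<close> therefore ranges
  over the positive integers in \<open>dp_chromatic_number\<close>, and \<open>dp_color_function G m\<close> is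
  meaningful for \<open>m \<ge> 1\<close> only.
\<close>

definition dp_chromatic_number :: "'a pair_pre_digraph \<Rightarrow> nat" (\<open>\<chi>\<^sub>D\<^sub>P\<close>) where
  "\<chi>\<^sub>D\<^sub>P G = (LEAST m. m \<ge> 1 \<and>
     (\<forall>L (H :: nat pair_pre_digraph). fold_cover m G L H \<longrightarrow> dp_colorings G H \<noteq> {}))"

definition dp_color_function :: "'a pair_pre_digraph \<Rightarrow> nat \<Rightarrow> nat" (\<open>P\<^sub>D\<^sub>P\<close>) where
  "P\<^sub>D\<^sub>P G m = Inf {card (dp_colorings G H) | L (H :: nat pair_pre_digraph). fold_cover m G L H}"

lemma fold_cover_image:
  fixes H :: "'b pair_pre_digraph" and f :: "'b \<Rightarrow> 'c"
  assumes wfG: "pair_wf_digraph G" and cov: "fold_cover m G L H" and inj: "inj_on f (pverts H)"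
  defines "H' \<equiv> \<lparr> pverts = f ` pverts H, parcs = map_prod f f ` parcs H \<rparr>"
  shows "fold_cover m G (\<lambda>v. f ` L v) H'"
    and "bij_betw (image f) (dp_colorings G H) (dp_colorings G H')"
proof -
  have dc: "dp_cover G L H" and card_L: "\<And>v. v \<in> pverts G \<Longrightarrow> card (L v) = m"
    using cov by (auto simp: fold_cover_def)
  have neg: "nonempty_graph H" and part: "partition_on (pverts H) (L ` pverts G)"
    and cardL: "card (L ` pverts G) = card (pverts G)"
    and compl: "\<And>v. v \<in> pverts G \<Longrightarrow> complete_digraph (card (L v)) (with_proj H \<restriction> L v)"
    and edg: "\<And>u v. u \<in> pverts G \<Longrightarrow> v \<in> pverts G \<Longrightarrow>
        edges_between H (L u) (L v) \<noteq> {} \<Longrightarrow> u = v \<or> (u, v) \<in> parcs G"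
    and mat: "\<And>u v. (u, v) \<in> parcs G \<Longrightarrow> matching (edges_between H (L u) (L v))"
    using dc unfolding dp_cover_def by blast+
  interpret pair_graph H using neg by (simp add: nonempty_graph_def)
  have arc_V: "x \<in> pverts H \<and> y \<in> pverts H" if "(x, y) \<in> parcs H" for x y
    using that in_arcsD1 in_arcsD2 by blast
  have arc': "(f x, f y) \<in> parcs H' \<longleftrightarrow> (x, y) \<in> parcs H"
    if "x \<in> pverts H" "y \<in> pverts H" for x y
  proof
    assume "(f x, f y) \<in> parcs H'"
    then obtain a b where ab: "(a, b) \<in> parcs H" "f x = f a" "f y = f b"
      by (auto simp: H'_def)
    then have "x = a" "y = b" using arc_V[OF ab(1)] that inj by (auto dest: inj_onD)
    then show "(x, y) \<in> parcs H" using ab(1) by simp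
  qed (force simp: H'_def)
  have pg: "pair_graph H'"
  proof
    fix e assume "e \<in> parcs H'"
    then obtain a b where ab: "(a, b) \<in> parcs H" "e = (f a, f b)" by (auto simp: H'_def)
    with arc_V[OF ab(1)] show "fst e \<in> pverts H'" "snd e \<in> pverts H'" by (auto simp: H'_def)
    have "a \<noteq> b" using ab(1) pair_no_loops by fastforce
    with ab arc_V[OF ab(1)] inj show "fst e \<noteq> snd e" by (auto dest: inj_onD)
  next
    show "finite (pverts H')" "finite (parcs H')" by (auto simp: H'_def)
    show "symmetric (with_proj H')"
      using arcs_symmetric by (auto simp: symmetric_def H'_def intro!: symI)
  qed
  have L_sub: "L v \<subseteq> pverts H" if "v \<in> pverts G" for v
    using part that by (auto simp: partition_on_def)
  have inj_im: "inj_on (image f) (Pow (pverts H))"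
    using inj by (rule inj_on_image_Pow)
  have eb: "edges_between H' (f ` A) (f ` B) = image f ` edges_between H A B"
    if "A \<subseteq> pverts H" "B \<subseteq> pverts H" for A B
  proof -
    have "edges_between H' (f ` A) (f ` B) = {{f x, f y} | x y. x \<in> A \<and> y \<in> B \<and> (f x, f y) \<in> parcs H'}"
      by (auto simp: edges_between_def)
    also have "\<dots> = {f ` {x, y} | x y. x \<in> A \<and> y \<in> B \<and> (x, y) \<in> parcs H}"
      using that arc' by (auto; blast)
    also have "\<dots> = image f ` edges_between H A B"
      unfolding edges_between_def by blast
    finally show ?thesis .
  qed
  have "partition_on (pverts H') ((\<lambda>v. f ` L v) ` pverts G)"
  proof (rule partition_onI)
    show "\<Union> ((\<lambda>v. f ` L v) ` pverts G) = pverts H'"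
      using part by (simp add: partition_on_def H'_def flip: image_UN)
    show "{} \<notin> (\<lambda>v. f ` L v) ` pverts G" using part by (auto simp: partition_on_def)
  next
    fix p q assume "p \<in> (\<lambda>v. f ` L v) ` pverts G" "q \<in> (\<lambda>v. f ` L v) ` pverts G" "p \<noteq> q"
    then obtain u v where uv: "u \<in> pverts G" "v \<in> pverts G" "p = f ` L u" "q = f ` L v" "L u \<noteq> L v"
      by auto
    then have "L u \<inter> L v = {}" using part by (auto simp: partition_on_def disjoint_def)
    then have "f ` L u \<inter> f ` L v = {}"
      using inj_on_image_Int[OF inj L_sub[OF uv(1)] L_sub[OF uv(2)]] by simp
    then show "disjnt p q" using uv by (simp add: disjnt_def)
  qed
  moreover have "card ((\<lambda>v. f ` L v) ` pverts G) = card (pverts G)"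
  proof -
    have "inj_on (image f) (L ` pverts G)"
      by (rule inj_on_subset[OF inj_im]) (use L_sub in auto)
    then have "card (image f ` L ` pverts G) = card (L ` pverts G)" by (rule card_image)
    then show ?thesis using cardL by (simp add: image_image)
  qed
  moreover have card_f: "card (f ` L v) = card (L v)" if "v \<in> pverts G" for v
    using inj L_sub[OF that] by (metis card_image inj_on_subset)
  moreover have "complete_digraph (card (f ` L v)) (with_proj H' \<restriction> f ` L v)"
    if v: "v \<in> pverts G" for v
  proof -
    interpret H': pair_graph H' by (rule pg)
    have 1: "f ` L v \<subseteq> pverts H'" using L_sub[OF v] by (auto simp: H'_def)
    have 2: "graph (with_proj H' \<restriction> f ` L v)"
    proof -
      have ind: "induced_subgraph (with_proj H' \<restriction> f ` L v) (with_proj H')"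
        using 1 by (rule H'.induced_induce)
      interpret D: digraph "with_proj H' \<restriction> f ` L v" using ind by (rule H'.digraphI_induced)
      interpret S: sym_digraph "with_proj H' \<restriction> f ` L v"
        using ind by (rule H'.induced_graph_imp_graph)
      show ?thesis by unfold_locales
    qed
    have 3: "(x, y) \<in> parcs H" if "x \<in> L v" "y \<in> L v" "x \<noteq> y" for x y
      using compl[OF v] that by (auto simp: complete_digraph_def arcs_ends_conv induce_subgraph_def set_eq_iff)
    show ?thesis
      unfolding complete_digraph_def using 2
    proof (intro conjI)
      show "arcs_ends (with_proj H' \<restriction> f ` L v) =
        {(a, b). (a, b) \<in> verts (with_proj H' \<restriction> f ` L v) \<times> verts (with_proj H' \<restriction> f ` L v) \<and> a \<noteq> b}"
        using 3 arc' L_sub[OF v] H'.pair_no_loops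
        by (fastforce simp: arcs_ends_conv induce_subgraph_def)
    qed auto
  qed
  moreover have "u = v \<or> (u, v) \<in> parcs G"
    if "u \<in> pverts G" "v \<in> pverts G" "edges_between H' (f ` L u) (f ` L v) \<noteq> {}" for u v
    using that edg L_sub eb by simp
  moreover have "matching (edges_between H' (f ` L u) (f ` L v))" if "(u, v) \<in> parcs G" for u v
  proof -
    have uv: "u \<in> pverts G" "v \<in> pverts G"
      using that pair_wf_digraph.in_arcsD1[OF wfG] pair_wf_digraph.in_arcsD2[OF wfG] by blast+
    have sub: "e \<subseteq> pverts H" if "e \<in> edges_between H (L u) (L v)" for e
      using that arc_V by (auto simp: edges_between_def)
    show ?thesis
      unfolding matching_def eb[OF L_sub[OF uv(1)] L_sub[OF uv(2)]]
    proof (rule pairwiseI)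
      fix d e assume "d \<in> image f ` edges_between H (L u) (L v)"
        "e \<in> image f ` edges_between H (L u) (L v)" "d \<noteq> e"
      then obtain d' e' where de: "d' \<in> edges_between H (L u) (L v)"
        "e' \<in> edges_between H (L u) (L v)" "d = f ` d'" "e = f ` e'" "d' \<noteq> e'" by auto
      then have "d' \<inter> e' = {}"
        using mat[OF that] by (auto simp: matching_def pairwise_def disjnt_def)
      then show "disjnt d e"
        using inj_on_image_Int[OF inj sub[OF de(1)] sub[OF de(2)]] de by (simp add: disjnt_def)
    qed
  qed
  ultimately show "fold_cover m G (\<lambda>v. f ` L v) H'"
    using pg neg card_L by (auto simp: fold_cover_def dp_cover_def nonempty_graph_def H'_def)
  have ind: "independent_set H' (f ` I) \<longleftrightarrow> independent_set H I" if "I \<subseteq> pverts H" for I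
    using that arc' by (auto simp: independent_set_def H'_def subset_iff)
  have cardI: "card (f ` I) = card I" if "I \<subseteq> pverts H" for I
    using inj that by (metis card_image inj_on_subset)
  show "bij_betw (image f) (dp_colorings G H) (dp_colorings G H')"
  proof (rule bij_betwI')
    fix I J assume "I \<in> dp_colorings G H" "J \<in> dp_colorings G H"
    then have "I \<subseteq> pverts H" "J \<subseteq> pverts H" by (auto simp: dp_colorings_def independent_set_def)
    then show "f ` I = f ` J \<longleftrightarrow> I = J" using inj by (simp add: inj_on_image_eq_iff)
  next
    fix I assume I: "I \<in> dp_colorings G H"
    then have "I \<subseteq> pverts H" by (auto simp: dp_colorings_def independent_set_def)
    then show "f ` I \<in> dp_colorings G H'" using I ind cardI by (simp add: dp_colorings_def)
  next
    fix J assume J: "J \<in> dp_colorings G H'"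
    then have "J \<subseteq> f ` pverts H" by (auto simp: dp_colorings_def independent_set_def H'_def)
    then obtain I where "I \<subseteq> pverts H" "J = f ` I" by (auto simp: subset_image_iff)
    then show "\<exists>I \<in> dp_colorings G H. J = f ` I"
      using J ind cardI by (auto simp: dp_colorings_def)
  qed
qed

corollary fold_cover_nat:
  fixes H :: "'b pair_pre_digraph"
  assumes "pair_wf_digraph G" and "fold_cover m G L H"
  shows "\<exists>L' (H' :: nat pair_pre_digraph). fold_cover m G L' H' \<and>
    card (dp_colorings G H') = card (dp_colorings G H) \<and>
    (dp_colorings G H' = {} \<longleftrightarrow> dp_colorings G H = {})"
proof -
  have "finite (pverts H)"
    using assms pair_fin_digraph.pair_finite_verts
    by (auto simp: fold_cover_def dp_cover_def nonempty_graph_def pair_graph_def pair_digraph_def)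
  then obtain f :: "'b \<Rightarrow> nat" where f: "inj_on f (pverts H)"
    using finite_imp_inj_to_nat_seg by metis
  note 1 = fold_cover_image[OF assms f]
  from 1(2) show ?thesis
    using 1(1) bij_betw_same_card[OF 1(2)] by (fastforce simp: bij_betw_def)
qed

end

theory Submission
  imports Defs
begin

text \<open>
  A cover amounts to lists of colors together with a symmetric conflict relation which is a partial
  matching along every edge, and its colorings are the conflict-free choice functions.

  Upper bound: color the \<open>k\<close> copies of \<open>G\<close> on the small side first. Each vertex of one of the
  remaining copies loses at most \<open>k\<close> colors, so at least \<open>\<chi>\<^sub>D\<^sub>P G\<close> are left.

  Lower bound, with \<open>m = \<chi>\<^sub>D\<^sub>P G + k - 1\<close>: put an \<open>m\<close>-fold cover of \<open>G\<close> with as few colorings as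
  possible on each of the \<open>k\<close> copies, and let the \<open>t\<close> remaining copies run through all \<open>k\<close>-tuples
  of such colorings. The copy of a tuple \<open>(c\<^sub>1, \<dots>, c\<^sub>k)\<close> carries a \<open>(\<chi>\<^sub>D\<^sub>P G - 1)\<close>-fold cover without
  coloring, enlarged by \<open>k\<close> colors of which the \<open>i\<close>-th conflicts with \<open>c\<^sub>i\<close>. If the first \<open>k\<close>
  copies are colored by this tuple, none of the additional colors can be used.
\<close>

section \<open>Covers as conflict assignments\<close>

text \<open>Lists of different vertices may overlap, and lists may be empty; the latter admits
  0-fold assignments, which no cover provides. Uniqueness is stated in one direction, since symmetry
  of \<open>R\<close> supplies the other.\<close>

definition conflict_assignment ::
    "'a pair_pre_digraph \<Rightarrow> ('a \<Rightarrow> 'c set) \<Rightarrow> ('a \<Rightarrow> 'c \<Rightarrow> 'a \<Rightarrow> 'c \<Rightarrow> bool) \<Rightarrow> bool" where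
  "conflict_assignment G A R \<longleftrightarrow>
     (\<forall>x \<in> pverts G. finite (A x)) \<and>
     (\<forall>x y c d. (x, y) \<in> parcs G \<longrightarrow> R x c y d \<longrightarrow> R y d x c) \<and>
     (\<forall>x y c d d'. (x, y) \<in> parcs G \<longrightarrow> c \<in> A x \<longrightarrow> d \<in> A y \<longrightarrow> d' \<in> A y \<longrightarrow>
        R x c y d \<longrightarrow> R x c y d' \<longrightarrow> d = d')"

text \<open>\<open>Pi\<^sub>E\<close> fixes the values outside \<open>pverts G\<close>, so distinct
  members differ at a vertex and can be counted against colorings of a cover.\<close>

definition conflict_free ::
    "'a pair_pre_digraph \<Rightarrow> ('a \<Rightarrow> 'c set) \<Rightarrow> ('a \<Rightarrow> 'c \<Rightarrow> 'a \<Rightarrow> 'c \<Rightarrow> bool) \<Rightarrow> ('a \<Rightarrow> 'c) set" where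
  "conflict_free G A R =
     {\<phi> \<in> Pi\<^sub>E (pverts G) A. \<forall>x y. (x, y) \<in> parcs G \<longrightarrow> \<not> R x (\<phi> x) y (\<phi> y)}"

text \<open>The condition whose least solution is \<open>\<chi>\<^sub>D\<^sub>P G\<close>.\<close>

definition dp_colorable :: "nat \<Rightarrow> 'a pair_pre_digraph \<Rightarrow> bool" where
  "dp_colorable m G \<longleftrightarrow> m \<ge> 1 \<and>
     (\<forall>L (H :: nat pair_pre_digraph). fold_cover m G L H \<longrightarrow> dp_colorings G H \<noteq> {})"

lemma nonempty_graphD:
  assumes "nonempty_graph G"
  shows "finite (pverts G)" and "pverts G \<noteq> {}"
    and "\<And>x y. (x, y) \<in> parcs G \<Longrightarrow> x \<in> pverts G \<and> y \<in> pverts G \<and> x \<noteq> y"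
    and "\<And>x y. (x, y) \<in> parcs G \<Longrightarrow> (y, x) \<in> parcs G"
    and "pair_wf_digraph G"
proof -
  interpret pair_graph G using assms by (simp add: nonempty_graph_def)
  show "finite (pverts G)" by simp
  show "pverts G \<noteq> {}" using assms by (simp add: nonempty_graph_def)
  show "pair_wf_digraph G" by unfold_locales
  fix x y assume "(x, y) \<in> parcs G"
  then show "x \<in> pverts G \<and> y \<in> pverts G \<and> x \<noteq> y" and "(y, x) \<in> parcs G"
    using in_arcsD1 in_arcsD2 pair_no_loops arcs_symmetric by fastforce+
qed

lemma nonempty_graphI:
  assumes "finite (pverts G)" and "pverts G \<noteq> {}"
    and arc: "\<And>x y. (x, y) \<in> parcs G \<Longrightarrow> x \<in> pverts G \<and> y \<in> pverts G \<and> x \<noteq> y \<and> (y, x) \<in> parcs G"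
  shows "nonempty_graph G"
proof -
  have "finite (parcs G)"
    by (rule finite_subset[of _ "pverts G \<times> pverts G"]) (use assms in auto)
  then have "pair_graph G"
    using assms by unfold_locales (auto simp: symmetric_def intro: symI dest: arc)
  then show ?thesis using assms by (simp add: nonempty_graph_def)
qed

section \<open>Translation between covers and conflict assignments\<close>

lemma dp_coverD:
  assumes "nonempty_graph G" and "dp_cover G L H"
  shows "nonempty_graph H"
    and "(\<Union>x\<in>pverts G. L x) = pverts H"
    and "\<And>x y c. x \<in> pverts G \<Longrightarrow> y \<in> pverts G \<Longrightarrow> c \<in> L x \<Longrightarrow> c \<in> L y \<Longrightarrow> x = y"
    and "\<And>x c d. x \<in> pverts G \<Longrightarrow> c \<in> L x \<Longrightarrow> d \<in> L x \<Longrightarrow> c \<noteq> d \<Longrightarrow> (c, d) \<in> parcs H"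
    and "\<And>x y c d. x \<in> pverts G \<Longrightarrow> y \<in> pverts G \<Longrightarrow> c \<in> L x \<Longrightarrow> d \<in> L y \<Longrightarrow>
      (c, d) \<in> parcs H \<Longrightarrow> x = y \<or> (x, y) \<in> parcs G"
    and "\<And>x y c d d'. (x, y) \<in> parcs G \<Longrightarrow> c \<in> L x \<Longrightarrow> d \<in> L y \<Longrightarrow> d' \<in> L y \<Longrightarrow>
      (c, d) \<in> parcs H \<Longrightarrow> (c, d') \<in> parcs H \<Longrightarrow> d = d'"
proof -
  note G = nonempty_graphD[OF assms(1)]
  have part: "partition_on (pverts H) (L ` pverts G)"
    and cardL: "card (L ` pverts G) = card (pverts G)"
    and compl: "\<And>v. v \<in> pverts G \<Longrightarrow> complete_digraph (card (L v)) (with_proj H \<restriction> L v)"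
    and edg: "\<And>u v. u \<in> pverts G \<Longrightarrow> v \<in> pverts G \<Longrightarrow>
        edges_between H (L u) (L v) \<noteq> {} \<Longrightarrow> u = v \<or> (u, v) \<in> parcs G"
    and mat: "\<And>u v. (u, v) \<in> parcs G \<Longrightarrow> matching (edges_between H (L u) (L v))"
    using assms(2) unfolding dp_cover_def by blast+
  show "nonempty_graph H" using assms(2) by (simp add: dp_cover_def)
  show "(\<Union>x\<in>pverts G. L x) = pverts H" using part by (simp add: partition_on_def)
  have injL: "inj_on L (pverts G)" using cardL G(1) by (simp add: eq_card_imp_inj_on)
  show "x = y" if "x \<in> pverts G" "y \<in> pverts G" "c \<in> L x" "c \<in> L y" for x y c
  proof -
    have "L x = L y"
      using part that by (auto simp: partition_on_def disjoint_def)
    then show ?thesis using injL that by (simp add: inj_on_def)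
  qed
  show "(c, d) \<in> parcs H" if "x \<in> pverts G" "c \<in> L x" "d \<in> L x" "c \<noteq> d" for x c d
    using compl[OF that(1)] that
    by (auto simp: complete_digraph_def arcs_ends_conv induce_subgraph_def set_eq_iff)
  show "x = y \<or> (x, y) \<in> parcs G"
    if "x \<in> pverts G" "y \<in> pverts G" "c \<in> L x" "d \<in> L y" "(c, d) \<in> parcs H" for x y c d
    using edg[OF that(1,2)] that by (auto simp: edges_between_def)
  show "d = d'" if xy: "(x, y) \<in> parcs G" and c: "c \<in> L x" "d \<in> L y" "d' \<in> L y"
      "(c, d) \<in> parcs H" "(c, d') \<in> parcs H" for x y c d d'
  proof -
    have e: "{c, d} \<in> edges_between H (L x) (L y)" "{c, d'} \<in> edges_between H (L x) (L y)"
      using c by (auto simp: edges_between_def)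
    \<comment> \<open>Both edges contain \<open>c\<close>, and edges of a matching that meet are
      equal.\<close>
    have "{c, d} = {c, d'}"
    proof (rule ccontr)
      assume "{c, d} \<noteq> {c, d'}"
      from pairwiseD[OF mat[OF xy, unfolded matching_def] e this] show False by simp
    qed
    then show ?thesis by (auto simp: doubleton_eq_iff)
  qed
qed

lemma conflict_assignment_dp_cover:
  assumes "nonempty_graph G" and "dp_cover G L H"
  shows "conflict_assignment G L (\<lambda>x c y d. (c, d) \<in> parcs H)"
proof -
  note C = dp_coverD[OF assms]
  note H = nonempty_graphD[OF C(1)]
  have "finite (L x)" if "x \<in> pverts G" for x
    using that C(2) H(1) finite_subset[of "L x" "pverts H"] by blast
  then show ?thesis
    using C(6) H(4) unfolding conflict_assignment_def by blast
qed

text \<open>Each list induces a clique, so an independent set meets it at most once. With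
  \<open>card (pverts G)\<close> elements it meets every list exactly once and is the image of a
  unique choice function.\<close>

lemma dp_colorings_bij:
  assumes "nonempty_graph G" and "dp_cover G L H"
  shows "bij_betw (\<lambda>\<phi>. \<phi> ` pverts G)
    (conflict_free G L (\<lambda>x c y d. (c, d) \<in> parcs H)) (dp_colorings G H)"
proof (rule bij_betwI')
  note G = nonempty_graphD[OF assms(1)]
  note C = dp_coverD[OF assms]
  note H = nonempty_graphD[OF C(1)]
  let ?S = "conflict_free G L (\<lambda>x c y d. (c, d) \<in> parcs H)"
  have in_L: "\<phi> x \<in> L x" if "\<phi> \<in> ?S" "x \<in> pverts G" for \<phi> x
    using that by (auto simp: conflict_free_def)
  {
    fix \<phi> \<psi> assume "\<phi> \<in> ?S" "\<psi> \<in> ?S"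
    show "(\<phi> ` pverts G = \<psi> ` pverts G) = (\<phi> = \<psi>)"
    proof
      assume eq: "\<phi> ` pverts G = \<psi> ` pverts G"
      have "\<phi> x = \<psi> x" if x: "x \<in> pverts G" for x
      proof -
        obtain y where y: "y \<in> pverts G" "\<phi> x = \<psi> y" using eq x by blast
        then have "x = y"
          using C(3)[OF x y(1)] in_L[OF \<open>\<phi> \<in> ?S\<close> x] in_L[OF \<open>\<psi> \<in> ?S\<close> y(1)] by simp
        then show ?thesis using y by simp
      qed
      then show "\<phi> = \<psi>"
        using \<open>\<phi> \<in> ?S\<close> \<open>\<psi> \<in> ?S\<close> by (auto simp: conflict_free_def intro: PiE_ext)
    qed simp
  next
    fix \<phi> assume \<phi>: "\<phi> \<in> ?S"
    have "inj_on \<phi> (pverts G)"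
      using in_L[OF \<phi>] C(3) by (metis inj_onI)
    then have "card (\<phi> ` pverts G) = card (pverts G)" by (rule card_image)
    moreover have "(\<phi> x, \<phi> y) \<notin> parcs H" if "x \<in> pverts G" "y \<in> pverts G" for x y
    proof
      assume a: "(\<phi> x, \<phi> y) \<in> parcs H"
      then have "x = y \<or> (x, y) \<in> parcs G" using C(5) in_L[OF \<phi>] that by blast
      then show False using a H(3) \<phi> by (auto simp: conflict_free_def)
    qed
    ultimately show "\<phi> ` pverts G \<in> dp_colorings G H"
      using in_L[OF \<phi>] C(2)[symmetric] by (auto simp: dp_colorings_def independent_set_def)
  next
    fix I assume "I \<in> dp_colorings G H"
    then have I: "I \<subseteq> pverts H" "\<And>c d. c \<in> I \<Longrightarrow> d \<in> I \<Longrightarrow> (c, d) \<notin> parcs H"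
      "card I = card (pverts G)"
      by (auto simp: dp_colorings_def independent_set_def)
    \<comment> \<open>\<open>p\<close> sends a color to the vertex whose list contains it. On
      \<open>I\<close> it is injective because two colors of one list are adjacent, and onto by the
      size of \<open>I\<close>; its inverse is the required choice function.\<close>
    define p where "p c = (SOME x. x \<in> pverts G \<and> c \<in> L x)" for c
    have p: "p c \<in> pverts G \<and> c \<in> L (p c)" if "c \<in> I" for c
      unfolding p_def by (rule someI_ex) (use that I(1) C(2) in auto)
    have inj: "inj_on p I"
      using p C(4) I(2) by (metis inj_onI)
    then have "card (p ` I) = card (pverts G)" using I(3) by (simp add: card_image)
    then have surj: "p ` I = pverts G"
      using p G(1) by (intro card_subset_eq) auto
    define \<phi> where "\<phi> = restrict (inv_into I p) (pverts G)"
    have \<phi>: "\<phi> x \<in> I" "p (\<phi> x) = x" if "x \<in> pverts G" for x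
      using that surj by (auto simp: \<phi>_def inv_into_into f_inv_into_f)
    have im: "I = \<phi> ` pverts G"
      using inv_into_image_cancel[OF inj, of I] surj by (simp add: \<phi>_def)
    have "\<phi> \<in> ?S"
      using \<phi> p I(2) G(3) unfolding conflict_free_def
      by (auto simp: \<phi>_def) (metis inv_into_into p surj f_inv_into_f)+
    with im show "\<exists>\<phi>\<in>?S. I = \<phi> ` pverts G" by blast
  }
qed

lemma finite_conflict_free:
  assumes "nonempty_graph G" and "conflict_assignment G A R"
  shows "finite (conflict_free G A R)"
  by (rule finite_subset[of _ "Pi\<^sub>E (pverts G) A"])
    (use assms nonempty_graphD(1) in \<open>auto simp: conflict_free_def conflict_assignment_def intro!: finite_PiE\<close>)

text \<open>Pairing each color with its vertex makes the lists disjoint, and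
  \<open>m \<ge> 1\<close> keeps the parts nonempty, as a partition demands.\<close>

lemma fold_cover_conflict_assignment:
  fixes A :: "'a \<Rightarrow> 'c set"
  assumes "nonempty_graph G" and CA: "conflict_assignment G A R"
    and card: "\<And>x. x \<in> pverts G \<Longrightarrow> card (A x) = m" and "m \<ge> 1"
  defines "H \<equiv> \<lparr> pverts = Sigma (pverts G) A, parcs = {((x, c), (y, d)) | x c y d.
      x \<in> pverts G \<and> y \<in> pverts G \<and> c \<in> A x \<and> d \<in> A y \<and>
      (x = y \<and> c \<noteq> d \<or> (x, y) \<in> parcs G \<and> R x c y d)} \<rparr>"
  shows "fold_cover m G (\<lambda>x. {x} \<times> A x) H"
proof -
  note G = nonempty_graphD[OF assms(1)]
  have fin: "\<And>x. x \<in> pverts G \<Longrightarrow> finite (A x)"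
    and sym: "\<And>x y c d. (x, y) \<in> parcs G \<Longrightarrow> R x c y d \<Longrightarrow> R y d x c"
    and uniq: "\<And>x y c d d'. (x, y) \<in> parcs G \<Longrightarrow> c \<in> A x \<Longrightarrow> d \<in> A y \<Longrightarrow> d' \<in> A y \<Longrightarrow>
        R x c y d \<Longrightarrow> R x c y d' \<Longrightarrow> d = d'"
    using CA unfolding conflict_assignment_def by blast+
  have ne: "A x \<noteq> {}" if "x \<in> pverts G" for x using card[OF that] \<open>m \<ge> 1\<close> by auto
  have "nonempty_graph H"
  proof (rule nonempty_graphI)
    show "finite (pverts H)" using G(1) fin by (simp add: H_def)
    show "pverts H \<noteq> {}" using G(2) ne by (auto simp: H_def)
    fix e f assume ef: "(e, f) \<in> parcs H"
    obtain x c y d where [simp]: "e = (x, c)" "f = (y, d)" by (cases e; cases f)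
    show "e \<in> pverts H \<and> f \<in> pverts H \<and> e \<noteq> f \<and> (f, e) \<in> parcs H"
      using ef sym[of x y c d] G(3,4)[of x y] by (auto simp: H_def)
  qed
  moreover have "partition_on (pverts H) ((\<lambda>x. {x} \<times> A x) ` pverts G)"
    using ne by (auto simp: partition_on_def disjoint_def H_def)
  moreover have "inj_on (\<lambda>x. {x} \<times> A x) (pverts G)"
    using ne by (fastforce simp: inj_on_def)
  then have "card ((\<lambda>x. {x} \<times> A x) ` pverts G) = card (pverts G)" by (rule card_image)
  moreover have "complete_digraph (card ({x} \<times> A x)) (with_proj H \<restriction> ({x} \<times> A x))"
    if x: "x \<in> pverts G" for x
  proof -
    have "with_proj H \<restriction> ({x} \<times> A x) = with_proj \<lparr> pverts = {x} \<times> A x,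
        parcs = {(p, q). (p, q) \<in> ({x} \<times> A x) \<times> ({x} \<times> A x) \<and> p \<noteq> q} \<rparr>"
      using x G(3) by (auto simp: induce_subgraph_def with_proj_def H_def)
    then show ?thesis
      using fin[OF x] by (simp only: complete_digraph_pair_def) auto
  qed
  moreover have "x = y \<or> (x, y) \<in> parcs G"
    if "edges_between H ({x} \<times> A x) ({y} \<times> A y) \<noteq> {}" for x y
    using that by (auto simp: edges_between_def H_def)
  moreover have "matching (edges_between H ({x} \<times> A x) ({y} \<times> A y))"
    if xy: "(x, y) \<in> parcs G" for x y
    unfolding matching_def
  proof (rule pairwiseI, rule ccontr)
    fix e f assume "e \<in> edges_between H ({x} \<times> A x) ({y} \<times> A y)"
      "f \<in> edges_between H ({x} \<times> A x) ({y} \<times> A y)" and ef: "e \<noteq> f" "\<not> disjnt e f"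
    then obtain c d c' d' where
      e: "e = {(x, c), (y, d)}" "c \<in> A x" "d \<in> A y" "R x c y d" and
      f: "f = {(x, c'), (y, d')}" "c' \<in> A x" "d' \<in> A y" "R x c' y d'"
      using G(3)[OF xy] by (auto simp: edges_between_def H_def)
    have "c = c' \<or> d = d'" using ef(2) e(1) f(1) G(3)[OF xy] by (auto simp: disjnt_def)
    \<comment> \<open>A color shared at one end forces equality at the other: \<open>uniq\<close>
      applies along \<open>(x, y)\<close> or, after \<open>sym\<close>, along the reverse
      arc.\<close>
    then have "c = c' \<and> d = d'"
      using uniq[OF xy] uniq[of y x] sym[OF xy] G(4)[OF xy] e f by metis
    then show False using ef(1) e(1) f(1) by simp
  qed
  ultimately show ?thesis
    using card by (auto simp: fold_cover_def dp_cover_def card_cartesian_product)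
qed

text \<open>Shrinking the lists to \<open>m\<close> colors each and moving the resulting cover to
  \<open>nat\<close> leads back to the definition. Colorability is applied in this form, with larger
  lists and colors of any type.\<close>

lemma dp_colorable_conflict_free:
  fixes A :: "'a \<Rightarrow> 'c set"
  assumes G: "nonempty_graph G" and col: "dp_colorable m G"
    and CA: "conflict_assignment G A R"
    and card: "\<And>x. x \<in> pverts G \<Longrightarrow> card (A x) \<ge> m"
  shows "conflict_free G A R \<noteq> {}"
proof -
  have "\<exists>B. \<forall>x\<in>pverts G. B x \<subseteq> A x \<and> card (B x) = m"
    using card by (intro bchoice ballI) (metis obtain_subset_with_card_n)
  then obtain B where B: "\<And>x. x \<in> pverts G \<Longrightarrow> B x \<subseteq> A x \<and> card (B x) = m" by blast
  have sub: "c \<in> A x" if "x \<in> pverts G" "c \<in> B x" for x c using B that by blast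
  have "conflict_assignment G B R"
    using CA B nonempty_graphD(3)[OF G] unfolding conflict_assignment_def
    by (meson finite_subset sub)
  moreover have "m \<ge> 1" using col by (simp add: dp_colorable_def)
  ultimately obtain H where fc: "fold_cover m G (\<lambda>x. {x} \<times> B x) H" and
    H: "H = \<lparr> pverts = Sigma (pverts G) B, parcs = {((x, c), (y, d)) | x c y d.
      x \<in> pverts G \<and> y \<in> pverts G \<and> c \<in> B x \<and> d \<in> B y \<and>
      (x = y \<and> c \<noteq> d \<or> (x, y) \<in> parcs G \<and> R x c y d)} \<rparr>"
    using fold_cover_conflict_assignment[OF G] B by blast
  from fold_cover_nat[OF nonempty_graphD(5)[OF G] fc] have "dp_colorings G H \<noteq> {}"
    using col unfolding dp_colorable_def by blast
  moreover have "dp_cover G (\<lambda>x. {x} \<times> B x) H" using fc by (simp add: fold_cover_def)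
  ultimately obtain \<phi> where
    "\<phi> \<in> conflict_free G (\<lambda>x. {x} \<times> B x) (\<lambda>x c y d. (c, d) \<in> parcs H)"
    using dp_colorings_bij[OF G] by (fastforce simp: bij_betw_def)
  then have \<phi>: "\<And>x. x \<in> pverts G \<Longrightarrow> \<phi> x \<in> {x} \<times> B x"
    "\<And>x y. (x, y) \<in> parcs G \<Longrightarrow> (\<phi> x, \<phi> y) \<notin> parcs H"
    by (auto simp: conflict_free_def)
  define \<psi> where "\<psi> = restrict (snd \<circ> \<phi>) (pverts G)"
  have \<phi>\<psi>: "\<phi> x = (x, \<psi> x)" "\<psi> x \<in> B x" if "x \<in> pverts G" for x
    using \<phi>(1)[OF that] that by (auto simp: \<psi>_def)
  have "\<not> R x (\<psi> x) y (\<psi> y)" if "(x, y) \<in> parcs G" for x y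
    using \<phi>(2)[OF that] nonempty_graphD(3)[OF G that] \<phi>\<psi> that by (simp add: H)
  moreover have "\<psi> \<in> Pi\<^sub>E (pverts G) A"
    using \<phi>\<psi>(2) sub by (auto simp: \<psi>_def)
  ultimately show ?thesis by (auto simp: conflict_free_def)
qed

text \<open>A failing cover itself serves, with adjacency in \<open>H\<close> as conflict; hence
  natural numbers suffice as colors.\<close>

lemma not_dp_colorableE:
  assumes G: "nonempty_graph G" and "\<not> dp_colorable m G" and "m \<ge> 1"
  obtains A :: "'a \<Rightarrow> nat set" and R where "conflict_assignment G A R"
    and "\<And>x. x \<in> pverts G \<Longrightarrow> card (A x) = m" and "conflict_free G A R = {}"
proof -
  obtain L and H :: "nat pair_pre_digraph"
    where LH: "fold_cover m G L H" "dp_colorings G H = {}"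
    using assms by (auto simp: dp_colorable_def)
  then have dc: "dp_cover G L H" by (simp add: fold_cover_def)
  show thesis
  proof (rule that)
    show "conflict_assignment G L (\<lambda>x c y d. (c, d) \<in> parcs H)"
      using conflict_assignment_dp_cover[OF G dc] .
    show "conflict_free G L (\<lambda>x c y d. (c, d) \<in> parcs H) = {}"
      using dp_colorings_bij[OF G dc] LH(2) by (simp add: bij_betw_def)
  qed (use LH in \<open>simp add: fold_cover_def\<close>)
qed

lemma dp_colorableI:
  fixes G :: "'a pair_pre_digraph"
  assumes "nonempty_graph G" and "m \<ge> 1"
    and "\<And>(A :: 'a \<Rightarrow> nat set) R. conflict_assignment G A R \<Longrightarrow>
      (\<And>x. x \<in> pverts G \<Longrightarrow> card (A x) = m) \<Longrightarrow> conflict_free G A R \<noteq> {}"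
  shows "dp_colorable m G"
  using assms not_dp_colorableE by metis

section \<open>Monotonicity of colorability, and attainment of both invariants\<close>

lemma dp_colorable_mono:
  fixes G :: "'a pair_pre_digraph"
  assumes "nonempty_graph G" and "dp_colorable m G" and "m \<le> n"
  shows "dp_colorable n G"
proof (rule dp_colorableI[OF assms(1)])
  show "n \<ge> 1" using assms(2,3) by (simp add: dp_colorable_def)
  fix A :: "'a \<Rightarrow> nat set" and R
  assume "conflict_assignment G A R" and "\<And>x. x \<in> pverts G \<Longrightarrow> card (A x) = n"
  then show "conflict_free G A R \<noteq> {}"
    using assms(3) by (intro dp_colorable_conflict_free[OF assms(1,2)]) simp_all
qed

text \<open>Each \<open>y\<close> excludes at most one color, so mapping \<open>y\<close> to that
  color covers the excluded set.\<close>

lemma card_excluded_le: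
  assumes "finite N"
    and "\<And>y c d. y \<in> N \<Longrightarrow> c \<in> A \<Longrightarrow> d \<in> A \<Longrightarrow> Q y c \<Longrightarrow> Q y d \<Longrightarrow> c = d"
  shows "card {c \<in> A. \<exists>y\<in>N. Q y c} \<le> card N"
proof -
  have "{c \<in> A. \<exists>y\<in>N. Q y c} \<subseteq> (\<lambda>y. THE c. c \<in> A \<and> Q y c) ` N"
  proof
    fix c assume "c \<in> {c \<in> A. \<exists>y\<in>N. Q y c}"
    then obtain y where y: "y \<in> N" "c \<in> A" "Q y c" by blast
    then have "(THE c. c \<in> A \<and> Q y c) = c" using assms(2) by blast
    then show "c \<in> (\<lambda>y. THE c. c \<in> A \<and> Q y c) ` N" using y by force
  qed
  then show ?thesis using assms(1) surj_card_le by blast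
qed

text \<open>Ensures that the minimum defining \<open>\<chi>\<^sub>D\<^sub>P G\<close> exists.
  Coloring is greedy: the vertices colored earlier exclude fewer than \<open>card (pverts G)\<close>
  colors at the current one.\<close>

lemma dp_colorable_card_verts:
  fixes G :: "'a pair_pre_digraph"
  assumes G: "nonempty_graph G"
  shows "dp_colorable (card (pverts G)) G"
proof (rule dp_colorableI[OF G])
  note G' = nonempty_graphD[OF G]
  show "card (pverts G) \<ge> 1" using G'(1,2) by (simp add: Suc_le_eq card_gt_0_iff)
  fix A :: "'a \<Rightarrow> nat set" and R
  assume CA: "conflict_assignment G A R"
    and card: "\<And>x. x \<in> pverts G \<Longrightarrow> card (A x) = card (pverts G)"
  have fin: "\<And>x. x \<in> pverts G \<Longrightarrow> finite (A x)"
    and sym: "\<And>x y c d. (x, y) \<in> parcs G \<Longrightarrow> R x c y d \<Longrightarrow> R y d x c"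
    and uniq: "\<And>x y c d d'. (x, y) \<in> parcs G \<Longrightarrow> c \<in> A x \<Longrightarrow> d \<in> A y \<Longrightarrow> d' \<in> A y \<Longrightarrow>
        R x c y d \<Longrightarrow> R x c y d' \<Longrightarrow> d = d'"
    using CA unfolding conflict_assignment_def by blast+
  have "S \<subseteq> pverts G \<Longrightarrow> \<exists>\<phi>. (\<forall>x\<in>S. \<phi> x \<in> A x) \<and>
      (\<forall>x\<in>S. \<forall>y\<in>S. (x, y) \<in> parcs G \<longrightarrow> \<not> R x (\<phi> x) y (\<phi> y))" if "finite S" for S
    using that
  proof (induction S)
    case (insert z S)
    then have "S \<subseteq> pverts G" by simp
    from insert.IH[OF this] obtain \<phi> where \<phi>: "\<And>x. x \<in> S \<Longrightarrow> \<phi> x \<in> A x"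
      "\<And>x y. x \<in> S \<Longrightarrow> y \<in> S \<Longrightarrow> (x, y) \<in> parcs G \<Longrightarrow> \<not> R x (\<phi> x) y (\<phi> y)"
      by blast
    let ?B = "{c \<in> A z. \<exists>y\<in>S. (y, z) \<in> parcs G \<and> R y (\<phi> y) z c}"
    have "card ?B \<le> card S"
      using insert \<phi>(1) uniq by (intro card_excluded_le) blast+
    also have "\<dots> < card (insert z S)" using insert by simp
    also have "\<dots> \<le> card (A z)" using insert.prems card G'(1) by (auto intro: card_mono)
    finally have "\<not> A z \<subseteq> ?B"
      using insert.prems card_mono[of ?B "A z"] fin[of z] by auto
    then obtain c where c: "c \<in> A z" "\<And>y. y \<in> S \<Longrightarrow> (y, z) \<in> parcs G \<Longrightarrow> \<not> R y (\<phi> y) z c"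
      by blast
    define \<psi> where "\<psi> = \<phi>(z := c)"
    have \<psi>: "\<psi> z = c" "\<And>x. x \<in> S \<Longrightarrow> \<psi> x = \<phi> x" using insert.hyps by (auto simp: \<psi>_def)
    have "\<not> R x (\<psi> x) y (\<psi> y)"
      if x: "x \<in> insert z S" and y: "y \<in> insert z S" and xy: "(x, y) \<in> parcs G" for x y
    proof -
      consider "x = z" "y \<in> S" | "x \<in> S" "y = z" | "x \<in> S" "y \<in> S"
        using x y G'(3)[OF xy] by blast
      then show ?thesis
      proof cases
        case 1
        then show ?thesis using c(2)[of y] sym[OF xy] G'(4)[OF xy] \<psi> by auto
      next
        case 2
        then show ?thesis using c(2)[of x] xy \<psi> by simp
      next
        case 3
        then show ?thesis using \<phi>(2) xy \<psi>(2) by simp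
      qed
    qed
    moreover have "\<forall>x\<in>insert z S. \<psi> x \<in> A x" using c(1) \<phi>(1) \<psi> by simp
    ultimately show ?case by blast
  qed simp
  from this[OF G'(1) subset_refl] obtain \<phi> where \<phi>: "\<forall>x\<in>pverts G. \<phi> x \<in> A x"
    "\<forall>x\<in>pverts G. \<forall>y\<in>pverts G. (x, y) \<in> parcs G \<longrightarrow> \<not> R x (\<phi> x) y (\<phi> y)" by blast
  then have "restrict \<phi> (pverts G) \<in> conflict_free G A R"
    using G'(3) by (auto simp: conflict_free_def)
  then show "conflict_free G A R \<noteq> {}" by blast
qed

lemma dp_chromatic_number_eq_Least: "\<chi>\<^sub>D\<^sub>P G = (LEAST m. dp_colorable m G)"
  by (simp add: dp_chromatic_number_def dp_colorable_def)

lemma dp_colorable_dp_chromatic_number: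
  "nonempty_graph G \<Longrightarrow> dp_colorable (\<chi>\<^sub>D\<^sub>P G) G"
  unfolding dp_chromatic_number_eq_Least using dp_colorable_card_verts by (rule LeastI)

text \<open>A nonempty set of naturals contains its infimum, so some cover has the fewest
  colorings.\<close>

lemma dp_color_function_attained:
  assumes G: "nonempty_graph G" and "m \<ge> 1"
  obtains A :: "'a \<Rightarrow> nat set" and R where "conflict_assignment G A R"
    and "\<And>x. x \<in> pverts G \<Longrightarrow> card (A x) = m" and "card (conflict_free G A R) = P\<^sub>D\<^sub>P G m"
proof -
  let ?X = "{card (dp_colorings G H) | L (H :: nat pair_pre_digraph). fold_cover m G L H}"
  \<comment> \<open>The assignment without conflicts shows that there is an \<open>m\<close>-fold
    cover at all.\<close>
  have "conflict_assignment G (\<lambda>_. {..<m}) (\<lambda>_ _ _ _. False)"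
    by (simp add: conflict_assignment_def)
  from fold_cover_conflict_assignment[OF G this _ assms(2)]
  obtain L and H :: "('a \<times> nat) pair_pre_digraph" where "fold_cover m G L H" by auto
  from fold_cover_nat[OF nonempty_graphD(5)[OF G] this]
  obtain L' and H' :: "nat pair_pre_digraph" where "fold_cover m G L' H'" by blast
  then have "card (dp_colorings G H') \<in> ?X" by blast
  then have "?X \<noteq> {}" by blast
  then have "Inf ?X \<in> ?X" by (rule Inf_nat_def1)
  then obtain L and H :: "nat pair_pre_digraph"
    where LH: "fold_cover m G L H" "card (dp_colorings G H) = P\<^sub>D\<^sub>P G m"
    unfolding dp_color_function_def by auto
  then have dc: "dp_cover G L H" by (simp add: fold_cover_def)
  show thesis
  proof (rule that)
    show "conflict_assignment G L (\<lambda>x c y d. (c, d) \<in> parcs H)"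
      using conflict_assignment_dp_cover[OF G dc] .
    show "card (conflict_free G L (\<lambda>x c y d. (c, d) \<in> parcs H)) = P\<^sub>D\<^sub>P G m"
      using bij_betw_same_card[OF dp_colorings_bij[OF G dc]] LH(2) by simp
  qed (use LH in \<open>simp add: fold_cover_def\<close>)
qed

section \<open>Products with complete bipartite graphs\<close>

lemma pverts_cartesian_product [simp]: "pverts (G \<box> K) = pverts G \<times> pverts K"
  by (simp add: cartesian_product_def)

lemma parcs_cartesian_product_iff:
  "((x, a), (y, b)) \<in> parcs (G \<box> K) \<longleftrightarrow>
     x \<in> pverts G \<and> a \<in> pverts K \<and> y \<in> pverts G \<and> b \<in> pverts K \<and>
     (x = y \<and> (a, b) \<in> parcs K \<or> a = b \<and> (x, y) \<in> parcs G)"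
  by (auto simp: cartesian_product_def)

lemma nonempty_graph_cartesian_product:
  assumes "nonempty_graph G" and "nonempty_graph K"
  shows "nonempty_graph (G \<box> K)"
proof (rule nonempty_graphI)
  note G = nonempty_graphD[OF assms(1)] and K = nonempty_graphD[OF assms(2)]
  show "finite (pverts (G \<box> K))" "pverts (G \<box> K) \<noteq> {}" using G(1,2) K(1,2) by auto
  fix p q assume pq: "(p, q) \<in> parcs (G \<box> K)"
  obtain x a y b where "p = (x, a)" "q = (y, b)" by (cases p; cases q)
  then show "p \<in> pverts (G \<box> K) \<and> q \<in> pverts (G \<box> K) \<and> p \<noteq> q \<and> (q, p) \<in> parcs (G \<box> K)"
    using pq G(3,4)[of x y] K(3,4)[of a b] by (auto simp: parcs_cartesian_product_iff)
qed

text \<open>\<open>U\<close> will have \<open>k\<close> elements and \<open>W\<close> will have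
  \<open>t\<close>; the copies of \<open>G\<close> are indexed by the vertices of \<open>K\<close>.
  One side may be empty, so \<open>k = 0\<close> is included.\<close>

locale bipartite_product =
  fixes G :: "'a pair_pre_digraph" and K :: "'b pair_pre_digraph" and U W :: "'b set"
  assumes G: "nonempty_graph G" and K: "nonempty_graph K"
    and verts_K: "pverts K = U \<union> W" and disj: "U \<inter> W = {}"
    and arcs_K: "parcs K = U \<times> W \<union> W \<times> U"
begin

lemmas G' = nonempty_graphD[OF G]

lemma finite_parts: "finite U" "finite W"
  using nonempty_graphD(1)[OF K] verts_K by auto

lemma nonempty_product: "nonempty_graph (G \<box> K)"
  using G K by (rule nonempty_graph_cartesian_product)

lemma arcs_product_iff:
  "((x, a), (y, b)) \<in> parcs (G \<box> K) \<longleftrightarrow>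
     x = y \<and> x \<in> pverts G \<and> (a \<in> U \<and> b \<in> W \<or> a \<in> W \<and> b \<in> U) \<or>
     a = b \<and> a \<in> U \<union> W \<and> (x, y) \<in> parcs G"
  using G'(3)[of x y] by (auto simp: parcs_cartesian_product_iff verts_K arcs_K)

section \<open>Upper bound: \<open>card U\<close> additional colors suffice\<close>

lemma dp_colorable_product:
  assumes col: "dp_colorable m G"
  shows "dp_colorable (m + card U) (G \<box> K)"
proof (rule dp_colorableI[OF nonempty_product])
  show "1 \<le> m + card U" using col by (simp add: dp_colorable_def)
  fix A :: "'a \<times> 'b \<Rightarrow> nat set" and R
  assume CA: "conflict_assignment (G \<box> K) A R"
    and card: "\<And>p. p \<in> pverts (G \<box> K) \<Longrightarrow> card (A p) = m + card U"
  have fin: "\<And>p. p \<in> pverts (G \<box> K) \<Longrightarrow> finite (A p)"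
    and sym: "\<And>p q c d. (p, q) \<in> parcs (G \<box> K) \<Longrightarrow> R p c q d \<Longrightarrow> R q d p c"
    and uniq: "\<And>p q c d d'. (p, q) \<in> parcs (G \<box> K) \<Longrightarrow> c \<in> A p \<Longrightarrow> d \<in> A q \<Longrightarrow> d' \<in> A q \<Longrightarrow>
        R p c q d \<Longrightarrow> R p c q d' \<Longrightarrow> d = d'"
    using CA unfolding conflict_assignment_def by blast+
  \<comment> \<open>A single copy of \<open>G\<close> can be colored from sublists of at least
    \<open>m\<close> colors. This is applied to full lists over \<open>U\<close> and to reduced
    lists over \<open>W\<close>.\<close>
  have layer: "\<exists>\<phi>. \<phi> \<in> conflict_free G B (\<lambda>x c y d. R (x, a) c (y, a) d)"
    if a: "a \<in> U \<union> W" and B: "\<And>x. x \<in> pverts G \<Longrightarrow> B x \<subseteq> A (x, a) \<and> m \<le> card (B x)" for a B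
  proof -
    have arc: "((x, a), (y, a)) \<in> parcs (G \<box> K)" if "(x, y) \<in> parcs G" for x y
      using that a by (simp add: arcs_product_iff)
    have "finite (B x)" if "x \<in> pverts G" for x
      using B[OF that] fin[of "(x, a)"] that a verts_K by (auto intro: finite_subset)
    moreover have "d = d'" if "(x, y) \<in> parcs G" "c \<in> B x" "d \<in> B y" "d' \<in> B y"
      "R (x, a) c (y, a) d" "R (x, a) c (y, a) d'" for x y c d d'
      using uniq[OF arc[OF that(1)]] that B G'(3)[OF that(1)] by blast
    ultimately have "conflict_assignment G B (\<lambda>x c y d. R (x, a) c (y, a) d)"
      using sym[OF arc] unfolding conflict_assignment_def by blast
    from dp_colorable_conflict_free[OF G col this] B show ?thesis by blast
  qed
  have "\<exists>\<phi>. \<forall>a\<in>U. \<phi> a \<in> conflict_free G (\<lambda>x. A (x, a)) (\<lambda>x c y d. R (x, a) c (y, a) d)"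
    using layer card verts_K by (intro bchoice ballI) auto
  then obtain \<phi> where
    \<phi>: "\<And>a. a \<in> U \<Longrightarrow> \<phi> a \<in> conflict_free G (\<lambda>x. A (x, a)) (\<lambda>x c y d. R (x, a) c (y, a) d)"
    by blast
  have \<phi>_in: "\<phi> a x \<in> A (x, a)" if "a \<in> U" "x \<in> pverts G" for a x
    using \<phi>[OF that(1)] that(2) by (auto simp: conflict_free_def)
  \<comment> \<open>The colors that \<open>(x, b)\<close> loses to the copies over \<open>U\<close>.
    Each \<open>a\<close> costs at most one, since \<open>(x, a)\<close> is the only neighbor of
    \<open>(x, b)\<close> in copy \<open>a\<close>.\<close>
  define E where "E b x = {c \<in> A (x, b). \<exists>a\<in>U. R (x, a) (\<phi> a x) (x, b) c}" for b x
  \<comment> \<open>No arcs join distinct copies over \<open>W\<close>, so these are colored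
    independently.\<close>
  have "\<exists>\<psi>. \<psi> \<in> conflict_free G (\<lambda>x. A (x, b) - E b x) (\<lambda>x c y d. R (x, b) c (y, b) d)"
    if b: "b \<in> W" for b
  proof (rule layer)
    fix x assume x: "x \<in> pverts G"
    have "card (E b x) \<le> card U"
      unfolding E_def using finite_parts(1)
    proof (rule card_excluded_le)
      fix a c d assume "a \<in> U" "c \<in> A (x, b)" "d \<in> A (x, b)"
        "R (x, a) (\<phi> a x) (x, b) c" "R (x, a) (\<phi> a x) (x, b) d"
      then show "c = d"
        using uniq[of "(x, a)" "(x, b)" "\<phi> a x" c d] \<phi>_in x b by (auto simp: arcs_product_iff)
    qed
    then have "m \<le> card (A (x, b) - E b x)"
      using card[of "(x, b)"] fin[of "(x, b)"] x b verts_K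
        diff_card_le_card_Diff[of "E b x" "A (x, b)"] by (auto simp: E_def)
    then show "A (x, b) - E b x \<subseteq> A (x, b) \<and> m \<le> card (A (x, b) - E b x)" by blast
  qed (use b in auto)
  then have "\<exists>\<psi>. \<forall>b\<in>W.
      \<psi> b \<in> conflict_free G (\<lambda>x. A (x, b) - E b x) (\<lambda>x c y d. R (x, b) c (y, b) d)"
    by (intro bchoice ballI)
  then obtain \<psi> where \<psi>: "\<And>b. b \<in> W \<Longrightarrow>
      \<psi> b \<in> conflict_free G (\<lambda>x. A (x, b) - E b x) (\<lambda>x c y d. R (x, b) c (y, b) d)"
    by blast
  have \<psi>_in: "\<psi> b x \<in> A (x, b)" "\<psi> b x \<notin> E b x" if "b \<in> W" "x \<in> pverts G" for b x
    using \<psi>[OF that(1)] that(2) by (auto simp: conflict_free_def)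
  define \<theta> where "\<theta> = (\<lambda>(x, a) \<in> pverts (G \<box> K). if a \<in> U then \<phi> a x else \<psi> a x)"
  have \<theta>: "\<theta> (x, a) = (if a \<in> U then \<phi> a x else \<psi> a x)"
    if "x \<in> pverts G" "a \<in> U \<union> W" for x a
    using that verts_K by (simp add: \<theta>_def)
  have cross: "\<not> R (x, a) (\<phi> a x) (x, b) (\<psi> b x)" if "x \<in> pverts G" "a \<in> U" "b \<in> W" for x a b
    using \<psi>_in[OF that(3,1)] that(2) by (auto simp: E_def)
  have "\<theta> \<in> Pi\<^sub>E (pverts (G \<box> K)) A"
    using \<phi>_in \<psi>_in verts_K by (auto simp: \<theta>_def)
  moreover have "\<not> R p (\<theta> p) q (\<theta> q)" if pq: "(p, q) \<in> parcs (G \<box> K)" for p q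
  proof
    assume conf: "R p (\<theta> p) q (\<theta> q)"
    obtain x a y b where [simp]: "p = (x, a)" "q = (y, b)" by (cases p; cases q)
    note pq' = pq[simplified, unfolded arcs_product_iff]
    consider "x = y" "x \<in> pverts G" "a \<in> U" "b \<in> W" | "x = y" "x \<in> pverts G" "a \<in> W" "b \<in> U"
      | "a = b" "(x, y) \<in> parcs G" "a \<in> U" | "a = b" "(x, y) \<in> parcs G" "a \<in> W"
      using pq' by blast
    moreover have WU: "w \<notin> U" if "w \<in> W" for w using that disj by blast
    ultimately show False
    proof cases
      case 1
      then show ?thesis using conf cross WU by (auto simp: \<theta>)
    next
      case 2
      then show ?thesis using sym[OF pq conf] cross WU by (auto simp: \<theta>)
    next
      case 3
      then show ?thesis using conf \<phi>[of a] G'(3) by (auto simp: \<theta> conflict_free_def)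
    next
      case 4
      then show ?thesis using conf \<psi>[of a] G'(3) WU by (auto simp: \<theta> conflict_free_def)
    qed
  qed
  ultimately have "\<theta> \<in> conflict_free (G \<box> K) A R"
    by (simp add: conflict_free_def)
  then show "conflict_free (G \<box> K) A R \<noteq> {}" by blast
qed

section \<open>Lower bound: a product cover without coloring\<close>

lemma not_dp_colorable_product:
  fixes A\<^sub>0 A\<^sub>1 :: "'a \<Rightarrow> 'c set"
  assumes CA1: "conflict_assignment G A\<^sub>1 R\<^sub>1" and CA0: "conflict_assignment G A\<^sub>0 R\<^sub>0"
    and card1: "\<And>x. x \<in> pverts G \<Longrightarrow> card (A\<^sub>1 x) = m + card U"
    and card0: "\<And>x. x \<in> pverts G \<Longrightarrow> card (A\<^sub>0 x) = m"
    and uncol: "conflict_free G A\<^sub>0 R\<^sub>0 = {}"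
    and le: "card (conflict_free G A\<^sub>1 R\<^sub>1) ^ card U \<le> card W"
  shows "\<not> dp_colorable (m + card U) (G \<box> K)"
proof
  assume col: "dp_colorable (m + card U) (G \<box> K)"
  \<comment> \<open>All tuples of colorings of the copies over \<open>U\<close>; by
    \<open>le\<close>, each can be given its own vertex of \<open>W\<close>.\<close>
  define T where "T = Pi\<^sub>E U (\<lambda>_. conflict_free G A\<^sub>1 R\<^sub>1)"
  have "finite T" "card T \<le> card W"
    unfolding T_def using finite_parts le finite_conflict_free[OF G CA1]
    by (auto simp: card_PiE intro: finite_PiE)
  then obtain g where g: "g ` T \<subseteq> W" "inj_on g T"
    using card_le_inj[OF _ finite_parts(2)] by blast
  \<comment> \<open>\<open>f b\<close> is the tuple against which copy \<open>b\<close> is built.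
    Its value off the range of \<open>g\<close> is arbitrary, which is harmless: the conflicts below
    form partial matchings for any tuple.\<close>
  define f where "f = inv_into T g"
  have f: "\<exists>b\<in>W. f b = \<tau>" if "\<tau> \<in> T" for \<tau>
    using that g by (intro bexI[of _ "g \<tau>"]) (auto simp: f_def)
  \<comment> \<open>\<open>Inl\<close> tags the given colors; \<open>Inr a\<close> is the extra
    color to be blocked by copy \<open>a\<close>.\<close>
  define A where "A = (\<lambda>(x, a). if a \<in> U then Inl ` A\<^sub>1 x else Inl ` A\<^sub>0 x \<union> Inr ` U)"
  \<comment> \<open>Inside a copy the given conflicts hold and extra colors have none. Between
    \<open>(x, a)\<close> and \<open>(x, b)\<close>, with \<open>a\<close> in \<open>U\<close> and
    \<open>b\<close> in \<open>W\<close>, only \<open>Inl (f b a x)\<close> and \<open>Inr a\<close>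
    conflict; the last branch is the mirror image.\<close>
  define R where "R = (\<lambda>(x, a) c (y, b) d.
    if a = b then \<exists>c' d'. c = Inl c' \<and> d = Inl d' \<and> (if a \<in> U then R\<^sub>1 else R\<^sub>0) x c' y d'
    else if a \<in> U then c = Inl (f b a x) \<and> d = Inr a
    else c = Inr b \<and> d = Inl (f a b x))"
  have fin: "finite (A\<^sub>1 x)" "finite (A\<^sub>0 x)" if "x \<in> pverts G" for x
    using CA1 CA0 that by (auto simp: conflict_assignment_def)
  have "conflict_assignment (G \<box> K) A R"
    unfolding conflict_assignment_def
  proof (intro conjI allI ballI impI)
    fix p assume "p \<in> pverts (G \<box> K)"
    then show "finite (A p)" using fin finite_parts by (auto simp: A_def)
  next
    fix p q c d assume "(p, q) \<in> parcs (G \<box> K)" and conf: "R p c q d"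
    then show "R q d p c"
      using CA1 CA0 disj unfolding conflict_assignment_def
      by (cases p; cases q) (auto simp: arcs_product_iff R_def split: if_splits)
  next
    fix p q c d d' assume "(p, q) \<in> parcs (G \<box> K)" "c \<in> A p" "d \<in> A q" "d' \<in> A q"
      "R p c q d" "R p c q d'"
    moreover have "\<And>x y c d d'. (x, y) \<in> parcs G \<Longrightarrow> c \<in> A\<^sub>1 x \<Longrightarrow> d \<in> A\<^sub>1 y \<Longrightarrow> d' \<in> A\<^sub>1 y \<Longrightarrow>
        R\<^sub>1 x c y d \<Longrightarrow> R\<^sub>1 x c y d' \<Longrightarrow> d = d'"
      and "\<And>x y c d d'. (x, y) \<in> parcs G \<Longrightarrow> c \<in> A\<^sub>0 x \<Longrightarrow> d \<in> A\<^sub>0 y \<Longrightarrow> d' \<in> A\<^sub>0 y \<Longrightarrow>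
        R\<^sub>0 x c y d \<Longrightarrow> R\<^sub>0 x c y d' \<Longrightarrow> d = d'"
      using CA1 CA0 unfolding conflict_assignment_def by blast+
    ultimately show "d = d'"
      using disj
      by (cases p; cases q) (auto simp: arcs_product_iff R_def A_def split: if_splits)
  qed
  moreover have "card (A p) = m + card U" if "p \<in> pverts (G \<box> K)" for p
  proof -
    obtain x a where [simp]: "p = (x, a)" by (cases p)
    have x: "x \<in> pverts G" using that by simp
    have "card (Inl ` A\<^sub>0 x \<union> Inr ` U) = card (A\<^sub>0 x) + card U"
      using card_Plus[OF fin(2)[OF x] finite_parts(1)] by (simp add: Plus_def)
    then show ?thesis using card1[OF x] card0[OF x] by (simp add: A_def card_image)
  qed
  ultimately obtain \<phi> where "\<phi> \<in> conflict_free (G \<box> K) A R"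
    using dp_colorable_conflict_free[OF nonempty_product col] by fastforce
  then have \<phi>: "\<phi> (x, a) \<in> A (x, a)" if "x \<in> pverts G" "a \<in> U \<union> W" for x a
    using that verts_K by (auto simp: conflict_free_def)
  have conf: "\<not> R p (\<phi> p) q (\<phi> q)" if "(p, q) \<in> parcs (G \<box> K)" for p q
    using \<open>\<phi> \<in> conflict_free (G \<box> K) A R\<close> that unfolding conflict_free_def by blast
  \<comment> \<open>The tuple read off from the copies over \<open>U\<close>, whose lists contain
    \<open>Inl\<close> colors only.\<close>
  define \<tau> where "\<tau> = (\<lambda>a\<in>U. \<lambda>x\<in>pverts G. projl (\<phi> (x, a)))"
  have \<tau>: "\<phi> (x, a) = Inl (\<tau> a x)" "\<tau> a x \<in> A\<^sub>1 x" if "a \<in> U" "x \<in> pverts G" for a x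
    using \<phi>[of x a] that by (auto simp: \<tau>_def A_def)
  have "\<tau> a \<in> conflict_free G A\<^sub>1 R\<^sub>1" if a: "a \<in> U" for a
  proof -
    have "\<not> R\<^sub>1 x (\<tau> a x) y (\<tau> a y)" if "(x, y) \<in> parcs G" for x y
      using conf[of "(x, a)" "(y, a)"] that a G'(3)[OF that] \<tau>(1)
      by (simp add: arcs_product_iff R_def)
    moreover have "\<tau> a \<in> Pi\<^sub>E (pverts G) A\<^sub>1"
      using \<tau>(2)[OF a] a by (auto simp: \<tau>_def)
    ultimately show ?thesis by (simp add: conflict_free_def)
  qed
  then have "\<tau> \<in> T" by (auto simp: T_def \<tau>_def)
  \<comment> \<open>Copy \<open>b\<close> was built against exactly this tuple.\<close>
  then obtain b where b: "b \<in> W" "f b = \<tau>" using f by blast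
  then have bU: "b \<notin> U" using disj by auto
  \<comment> \<open>\<open>(x, a)\<close> has color \<open>Inl (f b a x)\<close>, which blocks
    \<open>Inr a\<close> at \<open>(x, b)\<close>.\<close>
  have noInr: "\<phi> (x, b) \<noteq> Inr a" if "x \<in> pverts G" "a \<in> U" for x a
    using conf[of "(x, a)" "(x, b)"] that b bU \<tau>(1)[OF that(2,1)]
    by (auto simp: arcs_product_iff R_def split: if_splits)
  \<comment> \<open>Copy \<open>b\<close> is left with colors of \<open>A\<^sub>0\<close>, so it
    yields a member of the set that is empty by \<open>uncol\<close>.\<close>
  define \<psi> where "\<psi> = (\<lambda>x\<in>pverts G. projl (\<phi> (x, b)))"
  have \<psi>: "\<phi> (x, b) = Inl (\<psi> x)" "\<psi> x \<in> A\<^sub>0 x" if "x \<in> pverts G" for x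
    using \<phi>[of x b] noInr[OF that] that b bU by (auto simp: \<psi>_def A_def)
  have "\<not> R\<^sub>0 x (\<psi> x) y (\<psi> y)" if "(x, y) \<in> parcs G" for x y
    using conf[of "(x, b)" "(y, b)"] that b bU G'(3)[OF that] \<psi>(1)
    by (simp add: arcs_product_iff R_def)
  moreover have "\<psi> \<in> Pi\<^sub>E (pverts G) A\<^sub>0"
    using \<psi>(2) by (auto simp: \<psi>_def)
  ultimately show False using uncol by (auto simp: conflict_free_def)
qed

end

theorem theorem4:
  fixes G :: "'a pair_pre_digraph" and K :: "'b pair_pre_digraph" and k t :: nat
  assumes "nonempty_graph G"
    and "complete_bipartite_digraph k t (with_proj K)"
    and "t \<ge> (P\<^sub>D\<^sub>P G (\<chi>\<^sub>D\<^sub>P G + k - 1)) ^ k"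
  shows "\<chi>\<^sub>D\<^sub>P (G \<box> K) = \<chi>\<^sub>D\<^sub>P G + k"
proof -
  obtain U W where UW: "pverts K = U \<union> W" "U \<inter> W = {}" "card U = k" "card W = t"
    "parcs K = U \<times> W \<union> W \<times> U"
    using assms(2) unfolding complete_bipartite_digraph_pair_def by blast
  \<comment> \<open>For \<open>k = 0\<close> the power is 1, so the bound gives
    \<open>t \<ge> 1\<close>.\<close>
  have "k \<noteq> 0 \<or> t \<noteq> 0" using assms(3) by (cases k) auto
  then have "pverts K \<noteq> {}" using UW by auto
  moreover have "pair_graph K" using assms(2) by (rule pair_graphI_complete_bipartite)
  ultimately have K: "nonempty_graph K" by (simp add: nonempty_graph_def)
  interpret bipartite_product G K U W
    using assms(1) K UW by unfold_locales
  have col: "dp_colorable (\<chi>\<^sub>D\<^sub>P G) G" using G by (rule dp_colorable_dp_chromatic_number)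
  then have pos: "\<chi>\<^sub>D\<^sub>P G \<ge> 1" by (simp add: dp_colorable_def)
  obtain A\<^sub>0 :: "'a \<Rightarrow> nat set" and R\<^sub>0 where 0: "conflict_assignment G A\<^sub>0 R\<^sub>0"
    "\<And>x. x \<in> pverts G \<Longrightarrow> card (A\<^sub>0 x) = \<chi>\<^sub>D\<^sub>P G - 1" "conflict_free G A\<^sub>0 R\<^sub>0 = {}"
  proof (cases "\<chi>\<^sub>D\<^sub>P G = 1")
    \<comment> \<open>Here the lists have size 0. Empty lists admit no choice function because
      \<open>G\<close> has a vertex.\<close>
    case True
    show thesis
      by (rule that[of "\<lambda>_. {}" "\<lambda>_ _ _ _. False"])
        (use True G'(2) in \<open>auto simp: conflict_assignment_def conflict_free_def PiE_eq_empty_iff\<close>)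
  next
    case False
    have "\<not> dp_colorable (\<chi>\<^sub>D\<^sub>P G - 1) G"
      using pos not_less_Least[of "\<chi>\<^sub>D\<^sub>P G - 1" "\<lambda>m. dp_colorable m G"]
      by (simp add: dp_chromatic_number_eq_Least)
    moreover have "\<chi>\<^sub>D\<^sub>P G - 1 \<ge> 1" using False pos by simp
    ultimately show thesis using not_dp_colorableE[OF G] that by metis
  qed
  have uncol: "\<not> dp_colorable (\<chi>\<^sub>D\<^sub>P G + k - 1) (G \<box> K)"
  \<comment> \<open>The value 0 arises for \<open>\<chi>\<^sub>D\<^sub>P G = 1\<close> and
    \<open>k = 0\<close>; it is excluded by the clause \<open>m \<ge> 1\<close> in
    \<open>dp_colorable\<close>.\<close>
  proof (cases "\<chi>\<^sub>D\<^sub>P G + k - 1 = 0")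
    case False
    then obtain A\<^sub>1 :: "'a \<Rightarrow> nat set" and R\<^sub>1 where 1: "conflict_assignment G A\<^sub>1 R\<^sub>1"
      "\<And>x. x \<in> pverts G \<Longrightarrow> card (A\<^sub>1 x) = \<chi>\<^sub>D\<^sub>P G + k - 1"
      "card (conflict_free G A\<^sub>1 R\<^sub>1) = P\<^sub>D\<^sub>P G (\<chi>\<^sub>D\<^sub>P G + k - 1)"
      using dp_color_function_attained[OF G] by (metis One_nat_def Suc_leI not_gr_zero)
    \<comment> \<open>Since \<open>\<chi>\<^sub>D\<^sub>P G \<ge> 1\<close>, truncated subtraction
      allows this regrouping of \<open>\<chi>\<^sub>D\<^sub>P G + k - 1\<close>.\<close>
    have "\<not> dp_colorable (\<chi>\<^sub>D\<^sub>P G - 1 + card U) (G \<box> K)"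
      using 1 pos UW assms(3) by (intro not_dp_colorable_product[OF 1(1) 0(1) _ 0(2,3)]) auto
    then show ?thesis using pos UW by simp
  qed (simp add: dp_colorable_def)
  show ?thesis
    unfolding dp_chromatic_number_eq_Least[of "G \<box> K"]
  proof (rule Least_equality)
    show "dp_colorable (\<chi>\<^sub>D\<^sub>P G + k) (G \<box> K)"
      using dp_colorable_product[OF col] UW by simp
    fix m assume m: "dp_colorable m (G \<box> K)"
    show "\<chi>\<^sub>D\<^sub>P G + k \<le> m"
    proof (rule ccontr)
      assume "\<not> \<chi>\<^sub>D\<^sub>P G + k \<le> m"
      then have "m \<le> \<chi>\<^sub>D\<^sub>P G + k - 1" by simp
      then show False using dp_colorable_mono[OF nonempty_product m] uncol by blast
    qed
  qed
qed

end
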